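(* Let $\mathcal F=(G_\alpha,d_\alpha,\varepsilon_\alpha)_{\alpha\in I}$ be an approximating family, let $\ell\geqslant 0$, $m\geqslant 1$, and fix elements $a_1^\alpha,\ldots,a_\ell^\alpha\in G_\alpha$ for each $\alpha\in I$. Let $W\subseteq\mathbb F_\ell\ast\mathbb F_m$ be a finite system and $G=\mathbb F_\ell\ast\mathbb F_m/\langle W\rangle$, with $a_i\in G$ the image of $\bar a_i$. Then $W$ is constraint $\mathcal F$-approximable with respect to $a_1^\alpha,\ldots,a_\ell^\alpha\in G_\alpha$, $\alpha\in I$, if and only if there exist a non-principal ultrafilter $\omega$ over $\mathbb N$, a function $f\colon\mathbb N\to I$, and a group homomorphism $\theta\colon G\to\prod_{k\to\omega}(G_{f(k)},d_{f(k)})$ such that (i) $d_\omega(\theta(g),\theta(h))\geqslant\epsilon=\lim_{k\to\omega}\varepsilon_{f(k)}$ for every nontrivial distinct $g,h\in G$; (ii) $\theta(a_i)=\prod_{k\to\omega}a_i^{f(k)}$ for each $i=1,\ldots,\ell$.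
   Context: An approximating family $\mathcal F=(G_\alpha,d_\alpha,\varepsilon_\alpha)_{\alpha\in I}$, indexed by an arbitrary set $I$, consists of groups $G_\alpha$ with identity $1_\alpha$, bi-invariant distances $d_\alpha$ on $G_\alpha$, and strictly positive real numbers $\varepsilon_\alpha$ such that $\epsilon:=\inf_{\alpha\in I}\varepsilon_\alpha>0$. $\mathbb F_\ell$ is the free group on $\bar a_1,\ldots,\bar a_\ell$ and $\mathbb F_m$ the free group on $\bar x_1,\ldots,\bar x_m$; the length of an element of $\mathbb F_\ell\ast\mathbb F_m$ is its word length with respect to $\bar a_1,\ldots,\bar a_\ell,\bar x_1,\ldots,\bar x_m$. For $w\in\mathbb F_\ell\ast\mathbb F_m$ and elements $a_i,h_j$ of a group $H$, $w(a_1,\ldots,a_\ell,h_1,\ldots,h_m)$ is the image of $w$ under the homomorphism $\bar a_i\mapsto a_i$, $\bar x_j\mapsto h_j$. $\langle W\rangle$ is the normal subgroup of $\mathbb F_\ell\ast\mathbb F_m$ generated by $W$. For $\delta>0$, elements $h_1,\ldots,h_m\in G_\alpha$ are a strong $\delta$-solution of $W$ in $G_\alpha$ with coefficients $a_1^\alpha,\ldots,a_\ell^\alpha$ if for all $w\in\mathbb F_\ell\ast\mathbb F_m$ of length at most $1/\delta$: $d_\alpha(w(a_1^\alpha,\ldots,a_\ell^\alpha,h_1,\ldots,h_m),1_\alpha)<\delta$ if $w\in W$, and $d_\alpha(w(a_1^\alpha,\ldots,a_\ell^\alpha,h_1,\ldots,h_m),1_\alpha)\geqslant\varepsilon_\alpha-\delta$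 if $w\notin\langle W\rangle$. $W$ is constraint $\mathcal F$-approximable with respect to $a_1^\alpha,\ldots,a_\ell^\alpha\in G_\alpha$, $\alpha\in I$, if for every $\delta>0$ there is $\alpha\in I$ such that $W$ has a strong $\delta$-solution in $G_\alpha$ with coefficients $a_1^\alpha,\ldots,a_\ell^\alpha$. For a non-principal ultrafilter $\omega$ over $\mathbb N$ and $f\colon\mathbb N\to I$, the metric ultraproduct $\prod_{k\to\omega}(G_{f(k)},d_{f(k)})$ is the quotient of $\prod_{k\in\mathbb N}G_{f(k)}$ by the normal subgroup of all $(g_k)_k$ with $\lim_{k\to\omega}d_{f(k)}(g_k,1_{f(k)})=0$; the class of $(g_k)_k$ is written $\prod_{k\to\omega}g_k$, and the canonical bi-invariant metric is $d_\omega(\prod_{k\to\omega}g_k,\prod_{k\to\omega}h_k)=\lim_{k\to\omega}d_{f(k)}(g_k,h_k)$.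
   Formalization: It is assumed that the ε_α are bounded above or the d_α uniformly bounded; limits lie in the extended reals; (i) is required for all distinct g,h (trivial ones too) with bound lim ε_{f(k)}, and only inf ε_α ≤ lim ε_{f(k)} is claimed, since equality can fail. *)

theory Defs
  imports "HOL-Analysis.Analysis" "HOL-Algebra.Product_Groups"
begin

section \<open>Free groups as groups of reduced words\<close>

text \<open>The letter \<open>(x, True)\<close> stands for the generator \<open>x\<close>, the letter \<open>(x, False)\<close> for its inverse.
  Elements of the free group are the reduced words, so the word length of an element with respect
  to the generators is the length of the list.\<close>

type_synonym 'x word = "('x \<times> bool) list"

definition flip :: "'x \<times> bool \<Rightarrow> 'x \<times> bool" where
  "flip p = (fst p, \<not> snd p)"

fun reduced :: "'x word \<Rightarrow> bool" where
  "reduced (p # q # w) \<longleftrightarrow> q \<noteq> flip p \<and> reduced (q # w)"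
| "reduced _ \<longleftrightarrow> True"

fun push :: "'x \<times> bool \<Rightarrow> 'x word \<Rightarrow> 'x word" where
  "push p [] = [p]"
| "push p (q # w) = (if q = flip p then w else p # q # w)"

definition free_group :: "'x set \<Rightarrow> 'x word monoid" where
  "free_group X = \<lparr>carrier = {w. reduced w \<and> fst ` set w \<subseteq> X},
                   monoid.mult = foldr push,
                   one = []\<rparr>"

definition word_eval :: "('a, 'b) monoid_scheme \<Rightarrow> ('x \<Rightarrow> 'a) \<Rightarrow> 'x word \<Rightarrow> 'a" where
  "word_eval H \<phi> w =
     foldr (\<lambda>p z. (if snd p then \<phi> (fst p) else inv\<^bsub>H\<^esub> \<phi> (fst p)) \<otimes>\<^bsub>H\<^esub> z) w \<one>\<^bsub>H\<^esub>"

definition normal_closure :: "('a, 'b) monoid_scheme \<Rightarrow> 'a set \<Rightarrow> 'a set" where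
  "normal_closure F W = \<Inter> {N. N \<lhd> F \<and> W \<subseteq> N}"

text \<open>The free product of the free groups on \<open>Coeff 1, \<dots>, Coeff l\<close> and on \<open>Var 1, \<dots>, Var m\<close>, realised
  as the free group on the disjoint union of the two bases.\<close>

datatype gen = Coeff nat | Var nat

definition free_prod :: "nat \<Rightarrow> nat \<Rightarrow> gen word monoid" where
  "free_prod l m = free_group (Coeff ` {1..l} \<union> Var ` {1..m})"


section \<open>Approximating families and strong solutions\<close>

text \<open>The infimum is taken in the extended reals, so that nothing is demanded of an empty family.\<close>

locale approximating_family =
  fixes I :: "'i set"
    and G :: "'i \<Rightarrow> ('a, 'b) monoid_scheme"
    and d :: "'i \<Rightarrow> 'a \<Rightarrow> 'a \<Rightarrow> real"
    and \<epsilon> :: "'i \<Rightarrow> real"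
  assumes grp: "\<alpha> \<in> I \<Longrightarrow> group (G \<alpha>)"
    and metric: "\<alpha> \<in> I \<Longrightarrow> Metric_space (carrier (G \<alpha>)) (d \<alpha>)"
    and left_invariant: "\<lbrakk>\<alpha> \<in> I; g \<in> carrier (G \<alpha>); x \<in> carrier (G \<alpha>); y \<in> carrier (G \<alpha>)\<rbrakk>
           \<Longrightarrow> d \<alpha> (g \<otimes>\<^bsub>G \<alpha>\<^esub> x) (g \<otimes>\<^bsub>G \<alpha>\<^esub> y) = d \<alpha> x y"
    and right_invariant: "\<lbrakk>\<alpha> \<in> I; g \<in> carrier (G \<alpha>); x \<in> carrier (G \<alpha>); y \<in> carrier (G \<alpha>)\<rbrakk>
           \<Longrightarrow> d \<alpha> (x \<otimes>\<^bsub>G \<alpha>\<^esub> g) (y \<otimes>\<^bsub>G \<alpha>\<^esub> g) = d \<alpha> x y"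
    and eps_pos: "\<alpha> \<in> I \<Longrightarrow> 0 < \<epsilon> \<alpha>"
    and inf_eps_pos: "0 < (INF \<alpha>\<in>I. ereal (\<epsilon> \<alpha>))"

definition strong_solution ::
  "('a, 'b) monoid_scheme \<Rightarrow> ('a \<Rightarrow> 'a \<Rightarrow> real) \<Rightarrow> real \<Rightarrow> nat \<Rightarrow> nat \<Rightarrow> gen word set
     \<Rightarrow> (nat \<Rightarrow> 'a) \<Rightarrow> real \<Rightarrow> (nat \<Rightarrow> 'a) \<Rightarrow> bool" where
  "strong_solution H dist_H eps l m W a \<delta> h \<longleftrightarrow>
     (\<forall>j\<in>{1..m}. h j \<in> carrier H) \<and>
     (\<forall>w \<in> carrier (free_prod l m). real (length w) \<le> 1 / \<delta> \<longrightarrow>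
        (w \<in> W \<longrightarrow> dist_H (word_eval H (case_gen a h) w) \<one>\<^bsub>H\<^esub> < \<delta>) \<and>
        (w \<notin> normal_closure (free_prod l m) W \<longrightarrow>
           dist_H (word_eval H (case_gen a h) w) \<one>\<^bsub>H\<^esub> \<ge> eps - \<delta>))"

definition constraint_approximable ::
  "'i set \<Rightarrow> ('i \<Rightarrow> ('a, 'b) monoid_scheme) \<Rightarrow> ('i \<Rightarrow> 'a \<Rightarrow> 'a \<Rightarrow> real) \<Rightarrow> ('i \<Rightarrow> real)
     \<Rightarrow> nat \<Rightarrow> nat \<Rightarrow> gen word set \<Rightarrow> ('i \<Rightarrow> nat \<Rightarrow> 'a) \<Rightarrow> bool" where
  "constraint_approximable I G d \<epsilon> l m W a \<longleftrightarrow>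
     (\<forall>\<delta>>0. \<exists>\<alpha>\<in>I. \<exists>h. strong_solution (G \<alpha>) (d \<alpha>) (\<epsilon> \<alpha>) l m W (a \<alpha>) \<delta> h)"


section \<open>Metric ultraproducts\<close>

definition nonprincipal_ultrafilter :: "'k filter \<Rightarrow> bool" where
  "nonprincipal_ultrafilter \<omega> \<longleftrightarrow>
     \<omega> \<noteq> bot \<and>
     (\<forall>P. eventually P \<omega> \<or> eventually (\<lambda>k. \<not> P k) \<omega>) \<and>
     (\<forall>k. \<not> eventually (\<lambda>j. j = k) \<omega>)"

definition null_seqs ::
  "(nat \<Rightarrow> ('a, 'b) monoid_scheme) \<Rightarrow> (nat \<Rightarrow> 'a \<Rightarrow> 'a \<Rightarrow> real) \<Rightarrow> nat filter \<Rightarrow> (nat \<Rightarrow> 'a) set" where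
  "null_seqs G d \<omega> =
     {g \<in> carrier (product_group UNIV G). ((\<lambda>k. d k (g k) \<one>\<^bsub>G k\<^esub>) \<longlongrightarrow> 0) \<omega>}"

definition ultraproduct ::
  "(nat \<Rightarrow> ('a, 'b) monoid_scheme) \<Rightarrow> (nat \<Rightarrow> 'a \<Rightarrow> 'a \<Rightarrow> real) \<Rightarrow> nat filter \<Rightarrow> (nat \<Rightarrow> 'a) set monoid" where
  "ultraproduct G d \<omega> = product_group UNIV G Mod null_seqs G d \<omega>"

definition ultra_class ::
  "(nat \<Rightarrow> ('a, 'b) monoid_scheme) \<Rightarrow> (nat \<Rightarrow> 'a \<Rightarrow> 'a \<Rightarrow> real) \<Rightarrow> nat filter \<Rightarrow> (nat \<Rightarrow> 'a)
     \<Rightarrow> (nat \<Rightarrow> 'a) set" where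
  "ultra_class G d \<omega> g = null_seqs G d \<omega> #>\<^bsub>product_group UNIV G\<^esub> g"

text \<open>The distances are not assumed to be bounded, so the limit along \<open>\<omega>\<close> is taken in the extended
  reals, where it always exists; it is independent of the representatives, see
  \<open>tendsto_ultra_dist\<close> below.\<close>

definition ultra_dist ::
  "(nat \<Rightarrow> 'a \<Rightarrow> 'a \<Rightarrow> real) \<Rightarrow> nat filter \<Rightarrow> (nat \<Rightarrow> 'a) set \<Rightarrow> (nat \<Rightarrow> 'a) set \<Rightarrow> ereal" where
  "ultra_dist d \<omega> A B =
     (THE x. \<exists>g\<in>A. \<exists>h\<in>B. ((\<lambda>k. ereal (d k (g k) (h k))) \<longlongrightarrow> x) \<omega>)"


section \<open>The definitions behave as intended\<close>

lemma flip_flip [simp]: "flip (flip p) = p"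
  by (simp add: flip_def)

lemma fst_flip [simp]: "fst (flip p) = fst p"
  by (simp add: flip_def)

lemma reduced_tl: "reduced (p # w) \<Longrightarrow> reduced w"
  by (cases w) auto

lemma reduced_push: "reduced w \<Longrightarrow> reduced (push p w)"
  by (cases w) (auto dest: reduced_tl)

lemma push_flip: "reduced w \<Longrightarrow> push (flip p) (push p w) = w"
  by (cases w rule: reduced.cases) auto

lemma set_push: "set (push p w) \<subseteq> insert p (set w)"
  by (cases w) auto

lemma reduced_foldr_push: "reduced v \<Longrightarrow> reduced (foldr push u v)"
  by (induction u) (auto intro: reduced_push)

lemma set_foldr_push: "set (foldr push u v) \<subseteq> set u \<union> set v"
proof (induction u)
  case (Cons p u)
  then show ?case using set_push[of p "foldr push u v"] by auto
qed simp

lemma letters_foldr_push: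
  assumes "fst ` set u \<subseteq> X" "fst ` set v \<subseteq> X"
  shows "fst ` set (foldr push u v) \<subseteq> X"
proof -
  have "fst ` set (foldr push u v) \<subseteq> fst ` (set u \<union> set v)"
    by (rule image_mono[OF set_foldr_push])
  with assms show ?thesis unfolding image_Un by (meson Un_least order.trans)
qed

lemma foldr_push_Nil: "reduced w \<Longrightarrow> foldr push w [] = w"
  by (induction w rule: reduced.induct) (auto dest: reduced_tl)

lemma foldr_push_push:
  assumes "reduced u" "reduced v"
  shows "foldr push (push p u) v = push p (foldr push u v)"
proof (cases u)
  case (Cons q u')
  have "push p (push (flip p) (foldr push u' v)) = foldr push u' v"
    using push_flip[of "foldr push u' v" "flip p"] assms(2) by (simp add: reduced_foldr_push)
  with Cons show ?thesis by auto
qed simp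

lemma foldr_push_assoc:
  assumes "reduced v" "reduced w"
  shows "foldr push (foldr push u v) w = foldr push u (foldr push v w)"
  by (induction u) (use assms in \<open>auto simp: foldr_push_push reduced_foldr_push\<close>)

lemma group_free_group: "group (free_group X)"
proof (rule groupI)
  fix x assume "x \<in> carrier (free_group X)"
  then have x: "reduced x" "fst ` set x \<subseteq> X" by (auto simp: free_group_def)
  have *: "foldr push (foldr push (rev (map flip u)) []) u = []" if "reduced u" for u :: "'a word"
  proof -
    have "foldr push (rev (map flip u)) (foldr push u v) = v" if "reduced v" for v
      using that by (induction u arbitrary: v) (auto simp: push_flip reduced_foldr_push)
    from this[of "[]"] show ?thesis using that
      by (subst foldr_push_assoc) (auto simp: foldr_push_Nil)
  qed
  have "foldr push (rev (map flip x)) [] \<in> carrier (free_group X)"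
    using letters_foldr_push[of "rev (map flip x)" X "[]"] x
    by (simp add: free_group_def reduced_foldr_push image_image)
  with *[OF x(1)] show "\<exists>y\<in>carrier (free_group X). y \<otimes>\<^bsub>free_group X\<^esub> x = \<one>\<^bsub>free_group X\<^esub>"
    by (auto simp: free_group_def)
next
  fix x y assume "x \<in> carrier (free_group X)" "y \<in> carrier (free_group X)"
  then show "x \<otimes>\<^bsub>free_group X\<^esub> y \<in> carrier (free_group X)"
    using letters_foldr_push[of x X y] by (simp add: free_group_def reduced_foldr_push)
qed (auto simp: free_group_def foldr_push_assoc)

context
  fixes H :: "('a, 'b) monoid_scheme" and \<phi> :: "'x \<Rightarrow> 'a" and X :: "'x set"
  assumes H: "group H" and \<phi>: "\<phi> \<in> X \<rightarrow> carrier H"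
begin

interpretation group H by (rule H)

lemma word_eval_closed: "fst ` set w \<subseteq> X \<Longrightarrow> word_eval H \<phi> w \<in> carrier H"
  using \<phi> by (induction w) (auto simp: word_eval_def Pi_iff)

lemma word_eval_push:
  assumes "fst p \<in> X" "fst ` set w \<subseteq> X"
  shows "word_eval H \<phi> (push p w) =
    (if snd p then \<phi> (fst p) else inv\<^bsub>H\<^esub> \<phi> (fst p)) \<otimes>\<^bsub>H\<^esub> word_eval H \<phi> w"
proof (cases w)
  case (Cons q w')
  have "\<phi> (fst p) \<in> carrier H" "word_eval H \<phi> w' \<in> carrier H"
    using assms \<phi> Cons by (auto intro: word_eval_closed)
  then show ?thesis using Cons
    by (auto simp: word_eval_def flip_def m_assoc[symmetric])
qed (simp add: word_eval_def)

lemma word_eval_hom: "word_eval H \<phi> \<in> hom (free_group X) H"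
proof (rule homI)
  fix u v assume "u \<in> carrier (free_group X)" "v \<in> carrier (free_group X)"
  then have "fst ` set u \<subseteq> X" "fst ` set v \<subseteq> X" by (auto simp: free_group_def)
  then have "word_eval H \<phi> (foldr push u v) = word_eval H \<phi> u \<otimes>\<^bsub>H\<^esub> word_eval H \<phi> v"
  proof (induction u)
    case (Cons p u)
    have "fst ` set (foldr push u v) \<subseteq> X" using letters_foldr_push[of u X v] Cons.prems by simp
    moreover have "\<phi> (fst p) \<in> carrier H" using Cons.prems \<phi> by auto
    ultimately show ?case using Cons word_eval_closed[of u] word_eval_closed[of v]
      by (auto simp: word_eval_push) (auto simp: word_eval_def m_assoc)
  qed (use word_eval_closed[of v] in \<open>simp add: word_eval_def\<close>)
  then show "word_eval H \<phi> (u \<otimes>\<^bsub>free_group X\<^esub> v) = word_eval H \<phi> u \<otimes>\<^bsub>H\<^esub> word_eval H \<phi> v"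
    by (simp add: free_group_def)
qed (auto simp: free_group_def intro: word_eval_closed)

lemma word_eval_gen: "x \<in> X \<Longrightarrow> word_eval H \<phi> [(x, True)] = \<phi> x"
  using funcset_mem[OF \<phi>] by (simp add: word_eval_def)

end

lemma normal_closure_normal:
  assumes "group F" "W \<subseteq> carrier F"
  shows "normal_closure F W \<lhd> F"
proof -
  interpret group F by fact
  have ne: "carrier F \<in> {N. N \<lhd> F \<and> W \<subseteq> N}"
    using assms(2) by (auto simp: normal_inv_iff subgroup_self)
  show ?thesis
    unfolding normal_inv_iff
  proof
    show "subgroup (normal_closure F W) F"
      unfolding normal_closure_def
      by (rule subgroups_Inter) (use ne in \<open>auto simp: normal_inv_iff\<close>)
  qed (auto simp: normal_closure_def normal_inv_iff)
qed

lemma ultrafilter_tendsto: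
  fixes x :: "'k \<Rightarrow> ereal"
  assumes "nonprincipal_ultrafilter \<omega>"
  shows "\<exists>!l. (x \<longlongrightarrow> l) \<omega>"
proof -
  have nb: "\<omega> \<noteq> bot" and uf: "\<And>P. eventually P \<omega> \<or> eventually (\<lambda>k. \<not> P k) \<omega>"
    using assms by (auto simp: nonprincipal_ultrafilter_def)
  have "filtermap x \<omega> \<noteq> bot" using nb by (simp add: filtermap_bot_iff)
  then obtain l where l: "inf (nhds l) (filtermap x \<omega>) \<noteq> bot"
    using compact_UNIV[where ?'a = ereal] unfolding compact_filter by auto
  have "(x \<longlongrightarrow> l) \<omega>"
  proof (rule topological_tendstoI, rule ccontr)
    fix S assume S: "open S" "l \<in> S" "\<not> (\<forall>\<^sub>F k in \<omega>. x k \<in> S)"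
    then have "\<forall>\<^sub>F y in filtermap x \<omega>. y \<notin> S"
      using uf[of "\<lambda>k. x k \<in> S"] by (simp add: eventually_filtermap)
    moreover have "\<forall>\<^sub>F y in nhds l. y \<in> S" using S by (auto simp: eventually_nhds)
    ultimately have "eventually (\<lambda>_. False) (inf (nhds l) (filtermap x \<omega>))"
      unfolding eventually_inf by (intro exI conjI) auto
    then show False using l by (simp add: eventually_False)
  qed
  then show ?thesis using tendsto_unique[OF nb] by blast
qed

context
  fixes G :: "nat \<Rightarrow> ('a, 'b) monoid_scheme" and d :: "nat \<Rightarrow> 'a \<Rightarrow> 'a \<Rightarrow> real"
    and \<epsilon> :: "nat \<Rightarrow> real" and \<omega> :: "nat filter"
  assumes fam: "approximating_family UNIV G d \<epsilon>"
begin

interpretation approximating_family UNIV G d \<epsilon> by (rule fam)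

lemma null_seqs_normal: "null_seqs G d \<omega> \<lhd> product_group UNIV G"
proof -
  have g: "group (G k)" for k by (simp add: grp)
  have M: "Metric_space (carrier (G k)) (d k)" for k by (simp add: metric)
  interpret P: group "product_group UNIV G" by (simp add: g)
  have dinv: "d k (inv\<^bsub>G k\<^esub> x) \<one>\<^bsub>G k\<^esub> = d k x \<one>\<^bsub>G k\<^esub>" if "x \<in> carrier (G k)" for k x
    using left_invariant[of k x "inv\<^bsub>G k\<^esub> x" "\<one>\<^bsub>G k\<^esub>"] that g[of k]
    by (simp add: group.r_inv group.inv_closed monoid.one_closed group.is_monoid Metric_space.commute[OF M, of k "\<one>\<^bsub>G k\<^esub>"] monoid.r_one)
  have dmul: "d k (x \<otimes>\<^bsub>G k\<^esub> y) \<one>\<^bsub>G k\<^esub> \<le> d k x \<one>\<^bsub>G k\<^esub> + d k y \<one>\<^bsub>G k\<^esub>"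
    if "x \<in> carrier (G k)" "y \<in> carrier (G k)" for k x y
  proof -
    interpret k: group "G k" by (rule g)
    have "d k (x \<otimes>\<^bsub>G k\<^esub> y) \<one>\<^bsub>G k\<^esub> \<le> d k (x \<otimes>\<^bsub>G k\<^esub> y) (\<one>\<^bsub>G k\<^esub> \<otimes>\<^bsub>G k\<^esub> y) + d k y \<one>\<^bsub>G k\<^esub>"
      using Metric_space.triangle[OF M, of "x \<otimes>\<^bsub>G k\<^esub> y" k y "\<one>\<^bsub>G k\<^esub>"] that by simp
    also have "d k (x \<otimes>\<^bsub>G k\<^esub> y) (\<one>\<^bsub>G k\<^esub> \<otimes>\<^bsub>G k\<^esub> y) = d k x \<one>\<^bsub>G k\<^esub>"
      using that by (intro right_invariant) auto
    finally show ?thesis .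
  qed
  have dconj: "d k (x \<otimes>\<^bsub>G k\<^esub> y \<otimes>\<^bsub>G k\<^esub> inv\<^bsub>G k\<^esub> x) \<one>\<^bsub>G k\<^esub> = d k y \<one>\<^bsub>G k\<^esub>"
    if "x \<in> carrier (G k)" "y \<in> carrier (G k)" for k x y
  proof -
    interpret k: group "G k" by (rule g)
    have "d k (x \<otimes>\<^bsub>G k\<^esub> y \<otimes>\<^bsub>G k\<^esub> inv\<^bsub>G k\<^esub> x) (x \<otimes>\<^bsub>G k\<^esub> \<one>\<^bsub>G k\<^esub> \<otimes>\<^bsub>G k\<^esub> inv\<^bsub>G k\<^esub> x)
        = d k (x \<otimes>\<^bsub>G k\<^esub> y) (x \<otimes>\<^bsub>G k\<^esub> \<one>\<^bsub>G k\<^esub>)"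
      using that by (intro right_invariant) auto
    also have "\<dots> = d k y \<one>\<^bsub>G k\<^esub>"
      using that by (intro left_invariant) auto
    finally show ?thesis using that by simp
  qed
  have nn: "0 \<le> d k x y" for k x y using Metric_space.nonneg[OF M] .
  have d1: "d k \<one>\<^bsub>G k\<^esub> \<one>\<^bsub>G k\<^esub> = 0" for k
    using Metric_space.zero[OF M] monoid.one_closed[OF group.is_monoid[OF g]] by blast
  have sub: "subgroup (null_seqs G d \<omega>) (product_group UNIV G)"
  proof (rule P.subgroupI)
    show "null_seqs G d \<omega> \<noteq> {}"
    proof -
      have "\<one>\<^bsub>product_group UNIV G\<^esub> \<in> null_seqs G d \<omega>"
        using P.one_closed d1 monoid.one_closed[OF group.is_monoid[OF g]]
        by (simp add: null_seqs_def)
      then show ?thesis by blast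
    qed
  next
    fix a assume a: "a \<in> null_seqs G d \<omega>"
    then have aP: "a \<in> carrier (product_group UNIV G)" and c: "a k \<in> carrier (G k)" for k
      by (auto simp: null_seqs_def)
    have "(inv\<^bsub>product_group UNIV G\<^esub> a) k = inv\<^bsub>G k\<^esub> a k" for k
      using aP g by simp
    then have "((\<lambda>k. d k ((inv\<^bsub>product_group UNIV G\<^esub> a) k) \<one>\<^bsub>G k\<^esub>) \<longlongrightarrow> 0) \<omega>"
      using a c by (simp only: dinv) (simp add: null_seqs_def)
    then show "inv\<^bsub>product_group UNIV G\<^esub> a \<in> null_seqs G d \<omega>"
      unfolding null_seqs_def using P.inv_closed[OF aP] by blast
  next
    fix a b assume ab: "a \<in> null_seqs G d \<omega>" "b \<in> null_seqs G d \<omega>"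
    then have c: "a k \<in> carrier (G k)" "b k \<in> carrier (G k)" for k by (auto simp: null_seqs_def)
    have "((\<lambda>k. d k (a k) \<one>\<^bsub>G k\<^esub> + d k (b k) \<one>\<^bsub>G k\<^esub>) \<longlongrightarrow> 0 + 0) \<omega>"
      using ab by (intro tendsto_add) (auto simp: null_seqs_def)
    then have "((\<lambda>k. d k (a k) \<one>\<^bsub>G k\<^esub> + d k (b k) \<one>\<^bsub>G k\<^esub>) \<longlongrightarrow> 0) \<omega>"
      by simp
    moreover have "\<forall>\<^sub>F k in \<omega>. norm (d k (a k \<otimes>\<^bsub>G k\<^esub> b k) \<one>\<^bsub>G k\<^esub>) \<le> d k (a k) \<one>\<^bsub>G k\<^esub> + d k (b k) \<one>\<^bsub>G k\<^esub>"
      using dmul[OF c] nn by simp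
    ultimately have "((\<lambda>k. d k (a k \<otimes>\<^bsub>G k\<^esub> b k) \<one>\<^bsub>G k\<^esub>) \<longlongrightarrow> 0) \<omega>"
      by (rule Lim_null_comparison[rotated])
    moreover have "a \<in> carrier (product_group UNIV G)" "b \<in> carrier (product_group UNIV G)"
      using ab by (auto simp: null_seqs_def)
    ultimately show "a \<otimes>\<^bsub>product_group UNIV G\<^esub> b \<in> null_seqs G d \<omega>"
      using P.m_closed[of a b] by (simp add: null_seqs_def)
  qed (auto simp: null_seqs_def)
  show ?thesis
    unfolding P.normal_inv_iff
  proof (intro conjI ballI sub)
    fix x h assume x: "x \<in> carrier (product_group UNIV G)" and h: "h \<in> null_seqs G d \<omega>"
    then have hP: "h \<in> carrier (product_group UNIV G)"
      and c: "x k \<in> carrier (G k)" "h k \<in> carrier (G k)" for k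
      by (auto simp: null_seqs_def)
    let ?y = "x \<otimes>\<^bsub>product_group UNIV G\<^esub> h \<otimes>\<^bsub>product_group UNIV G\<^esub> inv\<^bsub>product_group UNIV G\<^esub> x"
    have "?y k = x k \<otimes>\<^bsub>G k\<^esub> h k \<otimes>\<^bsub>G k\<^esub> inv\<^bsub>G k\<^esub> x k" for k
      using x g by simp
    then have "((\<lambda>k. d k (?y k) \<one>\<^bsub>G k\<^esub>) \<longlongrightarrow> 0) \<omega>"
      using h c by (simp only: dconj) (simp add: null_seqs_def)
    then show "?y \<in> null_seqs G d \<omega>"
      unfolding null_seqs_def using P.m_closed[OF P.m_closed[OF x hP] P.inv_closed[OF x]] by blast
  qed
qed

lemma tendsto_ultra_dist:
  assumes \<omega>: "nonprincipal_ultrafilter \<omega>"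
    and g: "g \<in> carrier (product_group UNIV G)" and h: "h \<in> carrier (product_group UNIV G)"
  shows "((\<lambda>k. ereal (d k (g k) (h k))) \<longlongrightarrow>
           ultra_dist d \<omega> (ultra_class G d \<omega> g) (ultra_class G d \<omega> h)) \<omega>"
proof -
  have G: "group (G k)" for k by (simp add: grp)
  have M: "Metric_space (carrier (G k)) (d k)" for k by (simp add: metric)
  interpret P: group "product_group UNIV G" by (simp add: G)
  have nb: "\<omega> \<noteq> bot" using \<omega> by (simp add: nonprincipal_ultrafilter_def)
  obtain l where l: "((\<lambda>k. ereal (d k (g k) (h k))) \<longlongrightarrow> l) \<omega>" using ultrafilter_tendsto[OF \<omega>] by blast
  have rep: "((\<lambda>k. ereal (d k (g' k) (h' k))) \<longlongrightarrow> l) \<omega>"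
    if g': "g' \<in> ultra_class G d \<omega> g" and h': "h' \<in> ultra_class G d \<omega> h" for g' h'
  proof -
    obtain u v where uv: "u \<in> null_seqs G d \<omega>" "v \<in> null_seqs G d \<omega>"
      and e: "\<And>k. g' k = u k \<otimes>\<^bsub>G k\<^esub> g k" "\<And>k. h' k = v k \<otimes>\<^bsub>G k\<^esub> h k"
      using g' h' by (fastforce simp: ultra_class_def r_coset_def)
    have c: "u k \<in> carrier (G k)" "v k \<in> carrier (G k)" "g k \<in> carrier (G k)" "h k \<in> carrier (G k)" for k
      using uv g h by (auto simp: null_seqs_def)
    define b where "b k = d k (u k) \<one>\<^bsub>G k\<^esub> + d k (v k) \<one>\<^bsub>G k\<^esub>" for k
    have b0: "(b \<longlongrightarrow> 0) \<omega>"
      unfolding b_def using tendsto_add[of _ 0 \<omega> _ 0] uv by (fastforce simp: null_seqs_def)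
    have diff: "\<bar>d k (g' k) (h' k) - d k (g k) (h k)\<bar> \<le> b k" for k
    proof -
      interpret k: group "G k" by (rule G)
      interpret m: Metric_space "carrier (G k)" "d k" by (rule M)
      have c': "g' k \<in> carrier (G k)" "h' k \<in> carrier (G k)" using e c by auto
      have "d k (g' k) (g k) = d k (u k) \<one>\<^bsub>G k\<^esub>"
        using right_invariant[of k "g k" "u k" "\<one>\<^bsub>G k\<^esub>"] c e by simp
      moreover have "d k (h' k) (h k) = d k (v k) \<one>\<^bsub>G k\<^esub>"
        using right_invariant[of k "h k" "v k" "\<one>\<^bsub>G k\<^esub>"] c e by simp
      ultimately show ?thesis
        using m.triangle[of "g' k" "g k" "h' k"] m.triangle[of "g k" "h k" "h' k"]
          m.triangle[of "g k" "g' k" "h k"] m.triangle[of "g' k" "h' k" "h k"] c c'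
          m.commute[of "g k" "g' k"] m.commute[of "h k" "h' k"]
        by (auto simp: b_def abs_le_iff)
    qed
    have "((\<lambda>k. d k (g' k) (h' k) - d k (g k) (h k)) \<longlongrightarrow> 0) \<omega>"
      by (rule tendsto_0_le[OF b0, where K = 1]) (use diff in \<open>auto intro!: always_eventually order.trans[OF diff]\<close>)
    then have "((\<lambda>k. ereal (d k (g' k) (h' k) - d k (g k) (h k))) \<longlongrightarrow> ereal 0) \<omega>"
      by simp
    from tendsto_add_ereal_general1[OF _ l this] show ?thesis by (simp add: zero_ereal_def[symmetric])
  qed
  have "g \<in> ultra_class G d \<omega> g" "h \<in> ultra_class G d \<omega> h"
    using P.rcos_self[OF g] P.rcos_self[OF h] null_seqs_normal
    by (auto simp: ultra_class_def normal_imp_subgroup simp del: carrier_product_group)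
  then have "ultra_dist d \<omega> (ultra_class G d \<omega> g) (ultra_class G d \<omega> h) = l"
    unfolding ultra_dist_def by (intro the_equality) (use rep tendsto_unique[OF nb] l in blast)+
  with l show ?thesis by simp
qed

end

end

theory Submission
  imports Defs
begin

text \<open>Write \<open>F\<close> for the free product, \<open>N\<close> for the normal closure of \<open>W\<close>, and \<open>G\<^sub>k\<close> for the group with
  index \<open>f k\<close>. A homomorphism from \<open>F\<close> to the metric ultraproduct is the same as a choice of images
  for the generators, and these images lift to sequences \<open>\<phi> x\<close> with \<open>\<phi> x k \<in> G\<^sub>k\<close>. The homomorphism
  then sends a word to the class of the sequence of its values in the \<open>G\<^sub>k\<close>
  (\<open>free_group_hom_ultraproduct\<close>). So each property of the homomorphism at a word \<open>w\<close> is a statement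
  about the limit along \<open>\<omega>\<close> of the distances between the value of \<open>w\<close> in \<open>G\<^sub>k\<close> and the identity.

  From strong solutions to an embedding (\<open>ultraproduct_hom_of_strong_solutions\<close>): let the \<open>k\<close>-th
  components of the sequences be a strong \<open>1 / (k + 1)\<close>-solution. Every word is short enough for
  almost all \<open>k\<close>. So relators have values that tend to the identity, which makes the homomorphism
  factor through \<open>F Mod N\<close>, and a word outside \<open>N\<close> has values at distance at least \<open>\<epsilon> - 1 / (k + 1)\<close>
  from the identity, which gives the lower bound on distances in the limit. Bi-invariance reduces
  the distance of two elements to that of a quotient from the identity.

  From an embedding to strong solutions (\<open>strong_solution_of_ultraproduct_hom\<close>): a strong
  \<open>\<delta>\<close>-solution is subject to finitely many conditions only, because \<open>W\<close> and the set of words of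
  length at most \<open>1 / \<delta>\<close> are finite. Each of them holds for \<open>\<omega>\<close>-almost every \<open>k\<close>, hence all hold
  together for some \<open>k\<close>.\<close>


section \<open>Ultrafilters\<close>

text \<open>Zorn's lemma gives a minimal proper filter \<open>\<omega>\<close> below the given one. If \<open>P\<close> does not hold eventually,
  then adding the complement of \<open>P\<close> to \<open>\<omega>\<close> yields a proper filter, which minimality identifies with \<open>\<omega>\<close>.\<close>

lemma ex_ultrafilter_le:
  fixes F :: "'k filter"
  assumes "F \<noteq> bot"
  obtains \<omega> where "\<omega> \<le> F" "\<omega> \<noteq> bot" "\<And>P. eventually P \<omega> \<or> eventually (\<lambda>k. \<not> P k) \<omega>"
proof -
  define A where "A = {F'. F' \<noteq> bot \<and> F' \<le> F}"
  let ?R = "\<lambda>F F' :: 'k filter. F' \<le> F"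
  have "\<exists>\<omega>\<in>A. \<forall>F'\<in>A. F' \<le> \<omega> \<longrightarrow> F' = \<omega>"
  proof (rule predicate_Zorn)
    show "partial_order_on A (relation_of ?R A)"
      by (rule partial_order_on_relation_ofI) auto
  next
    fix C assume C: "C \<in> Chains (relation_of ?R A)"
    show "\<exists>u\<in>A. \<forall>F'\<in>C. u \<le> F'"
    proof (cases "C = {}")
      case True
      with assms show ?thesis by (auto simp: A_def)
    next
      case False
      have CA: "C \<subseteq> A" and lin: "\<And>F1 F2. F1 \<in> C \<Longrightarrow> F2 \<in> C \<Longrightarrow> F1 \<le> F2 \<or> F2 \<le> F1"
        using C by (auto simp: Chains_def relation_of_def)
      have "eventually P (Inf C) \<longleftrightarrow> (\<exists>F'\<in>C. eventually P F')" for P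
      proof (rule eventually_Inf_base[OF False])
        fix F1 F2 assume "F1 \<in> C" "F2 \<in> C"
        with lin[of F1 F2] show "\<exists>F'\<in>C. F' \<le> inf F1 F2" by auto
      qed
      then have "Inf C \<noteq> bot"
        using CA by (auto simp: A_def trivial_limit_def)
      moreover have "Inf C \<le> F"
        using False CA by (auto simp: A_def intro: Inf_lower2)
      ultimately show ?thesis
        by (intro bexI[of _ "Inf C"]) (auto simp: A_def Inf_lower)
    qed
  qed
  then obtain \<omega> where \<omega>: "\<omega> \<noteq> bot" "\<omega> \<le> F"
    and min: "\<And>F'. F' \<noteq> bot \<Longrightarrow> F' \<le> \<omega> \<Longrightarrow> F' = \<omega>"
    unfolding A_def by (metis (mono_tags, lifting) mem_Collect_eq order.trans)
  have "eventually (\<lambda>k. \<not> P k) \<omega>" if "\<not> eventually P \<omega>" for P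
  proof -
    let ?F = "inf \<omega> (principal {k. \<not> P k})"
    have "?F \<noteq> bot"
      using that by (simp add: trivial_limit_def eventually_inf_principal)
    then have "?F = \<omega>" by (intro min) auto
    then show ?thesis
      using eventually_inf_principal[of "\<lambda>k. \<not> P k" \<omega> "{k. \<not> P k}"] by simp
  qed
  with \<omega> that show thesis by blast
qed

lemma ex_nonprincipal_ultrafilter_nat:
  obtains \<omega> :: "nat filter" where "nonprincipal_ultrafilter \<omega>" "\<omega> \<le> sequentially"
proof -
  obtain \<omega> :: "nat filter" where \<omega>: "\<omega> \<le> sequentially" "\<omega> \<noteq> bot"
    "\<And>P. eventually P \<omega> \<or> eventually (\<lambda>k. \<not> P k) \<omega>"
    using ex_ultrafilter_le[OF sequentially_bot] by blast
  have "\<not> eventually (\<lambda>j. j = k) \<omega>" for k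
  proof
    assume "eventually (\<lambda>j. j = k) \<omega>"
    moreover have "eventually (\<lambda>j. k < j) \<omega>"
      by (rule filter_leD[OF \<omega>(1) eventually_gt_at_top])
    ultimately have "eventually (\<lambda>_. False) \<omega>"
      by eventually_elim auto
    with \<omega>(2) show False by (simp add: trivial_limit_def)
  qed
  with \<omega> show thesis by (intro that) (auto simp: nonprincipal_ultrafilter_def)
qed

text \<open>If the limit \<open>Y\<close> is finite, \<open>y\<close> is eventually at most slightly above \<open>Y\<close> and \<open>x\<close> at least slightly below it.
  Two sequences that both tend to infinity need not be comparable in this way; the boundedness of one of
  them excludes \<open>Y = \<infinity>\<close>, as \<open>Y \<le> X\<close>.\<close>

lemma eventually_diff_less_of_ereal_limits:
  fixes x y :: "'k \<Rightarrow> real"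
  assumes x: "((\<lambda>k. ereal (x k)) \<longlongrightarrow> X) \<omega>" and y: "((\<lambda>k. ereal (y k)) \<longlongrightarrow> Y) \<omega>"
    and nb: "\<omega> \<noteq> bot" and le: "Y \<le> X" and pos: "\<And>k. 0 < y k"
    and bdd: "(\<exists>C. \<forall>k. y k \<le> C) \<or> (\<exists>C. \<forall>k. x k \<le> C)" and \<delta>: "0 < \<delta>"
  shows "\<forall>\<^sub>F k in \<omega>. y k - \<delta> < x k"
proof (cases Y)
  case (real r)
  have "\<forall>\<^sub>F k in \<omega>. ereal (y k) < ereal (r + \<delta> / 2)"
    by (rule order_tendstoD(2)[OF y]) (use real \<delta> in auto)
  moreover have "ereal (r - \<delta> / 2) < Y"
    using real \<delta> by simp
  then have "\<forall>\<^sub>F k in \<omega>. ereal (r - \<delta> / 2) < ereal (x k)"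
    using le by (intro order_tendstoD(1)[OF x]) (rule less_le_trans)
  ultimately show ?thesis by eventually_elim simp
next
  case PInf
  have X: "X = \<infinity>" using le PInf by simp
  from bdd show ?thesis
  proof
    assume "\<exists>C. \<forall>k. y k \<le> C"
    then obtain C where "\<And>k. y k \<le> C" by blast
    then have "Y \<le> ereal C" by (intro tendsto_upperbound[OF y _ nb]) simp
    with PInf show ?thesis by simp
  next
    assume "\<exists>C. \<forall>k. x k \<le> C"
    then obtain C where "\<And>k. x k \<le> C" by blast
    then have "X \<le> ereal C" by (intro tendsto_upperbound[OF x _ nb]) simp
    with X show ?thesis by simp
  qed
next
  case MInf
  have "ereal 0 \<le> Y"
    by (rule tendsto_lowerbound[OF y _ nb]) (simp add: pos less_imp_le)
  with MInf show ?thesis by simp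
qed


section \<open>Words and homomorphisms\<close>

lemma word_eval_cong:
  assumes "\<And>x. x \<in> fst ` set w \<Longrightarrow> \<phi> x = \<psi> x"
  shows "word_eval H \<phi> w = word_eval H \<psi> w"
  using assms by (induction w) (auto simp: word_eval_def)

text \<open>This is used for three homomorphisms: those out of a free group, the projections of a product and the
  quotient map onto the ultraproduct.\<close>

lemma hom_word_eval:
  assumes H: "group H" and K: "group K" and t: "t \<in> hom H K"
    and \<phi>: "\<phi> \<in> X \<rightarrow> carrier H" and w: "fst ` set w \<subseteq> X"
  shows "t (word_eval H \<phi> w) = word_eval K (\<lambda>x. t (\<phi> x)) w"
proof -
  interpret group_hom H K t
    using H K t by (simp add: group_hom_def group_hom_axioms_def)
  show ?thesis
    using w
  proof (induction w)
    case Nil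
    then show ?case by (simp add: word_eval_def)
  next
    case (Cons p w)
    then have "\<phi> (fst p) \<in> carrier H" "word_eval H \<phi> w \<in> carrier H"
      using \<phi> word_eval_closed[OF H \<phi>, of w] by auto
    with Cons show ?case by (auto simp: word_eval_def)
  qed
qed

lemma inv_free_group_gen:
  assumes "x \<in> X"
  shows "inv\<^bsub>free_group X\<^esub> [(x, True)] = [(x, False)]"
proof -
  interpret group "free_group X" by (rule group_free_group)
  show ?thesis
    by (rule inv_equality) (use assms in \<open>auto simp: free_group_def flip_def\<close>)
qed

text \<open>A reduced word is its own value at the standard basis, so that values of an arbitrary homomorphism out of the free
  group can be computed by evaluating words.\<close>

lemma word_eval_free_group:
  assumes "w \<in> carrier (free_group X)"
  shows "word_eval (free_group X) (\<lambda>x. [(x, True)]) w = w"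
proof -
  have "word_eval (free_group X) (\<lambda>x. [(x, True)]) w = foldr push w []"
    if "fst ` set w \<subseteq> X" for w
    using that
  proof (induction w)
    case Nil
    then show ?case by (simp add: word_eval_def free_group_def)
  next
    case (Cons p w)
    have "(if snd p then [(fst p, True)] else inv\<^bsub>free_group X\<^esub> [(fst p, True)]) = [p]"
      using Cons.prems inv_free_group_gen[of "fst p" X] by (cases p) auto
    with Cons show ?case by (simp add: word_eval_def) (simp add: free_group_def)
  qed
  with assms show ?thesis by (simp add: free_group_def foldr_push_Nil)
qed

lemma free_group_hom_eq_word_eval:
  assumes H: "group H" and t: "t \<in> hom (free_group X) H" and w: "w \<in> carrier (free_group X)"
  shows "t w = word_eval H (\<lambda>x. t [(x, True)]) w"
proof -
  have "t (word_eval (free_group X) (\<lambda>x. [(x, True)]) w) = word_eval H (\<lambda>x. t [(x, True)]) w"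
    by (rule hom_word_eval[OF group_free_group H t, where X = X])
      (use w in \<open>auto simp: free_group_def\<close>)
  then show ?thesis by (simp add: word_eval_free_group[OF w])
qed

lemma word_eval_product_group:
  assumes G: "\<And>k. k \<in> K \<Longrightarrow> group (G k)" and \<phi>: "\<phi> \<in> X \<rightarrow> carrier (product_group K G)"
    and w: "fst ` set w \<subseteq> X" and k: "k \<in> K"
  shows "word_eval (product_group K G) \<phi> w k = word_eval (G k) (\<lambda>x. \<phi> x k) w"
  by (rule hom_word_eval[OF _ _ _ \<phi> w, where t = "\<lambda>g. g k"])
    (use G k in \<open>auto simp: hom_def\<close>)

lemma (in group) rcos_eq_iff:
  assumes "subgroup H G" "x \<in> carrier G" "y \<in> carrier G"
  shows "H #> x = H #> y \<longleftrightarrow> x \<otimes> inv y \<in> H"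
proof
  assume "H #> x = H #> y"
  then have "H #> (x \<otimes> inv y) = H"
    using coset_mult_inv2[of H x y] assms subgroup.subset[OF assms(1)] by blast
  then show "x \<otimes> inv y \<in> H"
    using coset_join1[of H "x \<otimes> inv y"] assms by blast
next
  assume "x \<otimes> inv y \<in> H"
  then have "H #> (x \<otimes> inv y) = H"
    using coset_join2[of "x \<otimes> inv y" H] assms by blast
  then show "H #> x = H #> y"
    using coset_mult_inv1[of H x y] assms subgroup.subset[OF assms(1)] by blast
qed

text \<open>Two elements of one coset differ by an element of \<open>N\<close>, which \<open>t\<close> kills.\<close>

lemma FactGroup_hom_of_subset_kernel:
  assumes F: "group F" and H: "group H" and t: "t \<in> hom F H"
    and N: "N \<lhd> F" and ker: "N \<subseteq> kernel F H t"
  obtains \<theta> where "\<theta> \<in> hom (F Mod N) H" "\<And>x. x \<in> carrier F \<Longrightarrow> \<theta> (N #>\<^bsub>F\<^esub> x) = t x"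
proof -
  interpret group_hom F H t
    using F H t by (simp add: group_hom_def group_hom_axioms_def)
  have "t x = t y" if xy: "x \<in> carrier F" "y \<in> carrier F" and eq: "N #>\<^bsub>F\<^esub> x = N #>\<^bsub>F\<^esub> y" for x y
  proof -
    have "x \<otimes>\<^bsub>F\<^esub> inv\<^bsub>F\<^esub> y \<in> kernel F H t"
      using G.rcos_eq_iff[OF normal_imp_subgroup[OF N] xy] eq ker by blast
    then have "t x \<otimes>\<^bsub>H\<^esub> inv\<^bsub>H\<^esub> t y = \<one>\<^bsub>H\<^esub>"
      using xy by (simp add: kernel_def)
    then show ?thesis
      using H.inv_equality[of "t x" "inv\<^bsub>H\<^esub> t y"] xy by simp
  qed
  then show thesis
    using FactGroup_universal[OF t N] that by blast
qed

lemma normal_closure_subset_kernel: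
  assumes F: "group F" and H: "group H" and t: "t \<in> hom F H"
    and W: "W \<subseteq> carrier F" "\<And>w. w \<in> W \<Longrightarrow> t w = \<one>\<^bsub>H\<^esub>"
  shows "normal_closure F W \<subseteq> kernel F H t"
proof -
  interpret group_hom F H t
    using F H t by (simp add: group_hom_def group_hom_axioms_def)
  show ?thesis
    using W normal_kernel by (auto simp: normal_closure_def kernel_def)
qed


section \<open>Homomorphisms into metric ultraproducts\<close>

text \<open>The constructions on metric ultraproducts are available for families indexed by all natural numbers; this passes
  to the sequence of groups selected by \<open>f\<close>. The infimum over a subfamily can only grow.\<close>

lemma approximating_family_reindex:
  assumes fam: "approximating_family I G d \<epsilon>" and f: "f \<in> UNIV \<rightarrow> I"
  shows "approximating_family UNIV (\<lambda>k. G (f k)) (\<lambda>k. d (f k)) (\<lambda>k. \<epsilon> (f k))"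
proof -
  interpret approximating_family I G d \<epsilon> by (rule fam)
  have fI: "f k \<in> I" for k using f by auto
  have "(INF \<alpha>\<in>I. ereal (\<epsilon> \<alpha>)) \<le> (INF k. ereal (\<epsilon> (f k)))"
    by (rule INF_mono) (use fI in auto)
  with inf_eps_pos have "0 < (INF k. ereal (\<epsilon> (f k)))" by (rule less_le_trans)
  then show ?thesis
    using fI
    by (intro approximating_family.intro)
      (simp_all add: grp metric left_invariant right_invariant eps_pos)
qed

lemma (in approximating_family) dist_eq_dist_one:
  assumes "\<alpha> \<in> I" "g \<in> carrier (G \<alpha>)" "h \<in> carrier (G \<alpha>)"
  shows "d \<alpha> g h = d \<alpha> (g \<otimes>\<^bsub>G \<alpha>\<^esub> inv\<^bsub>G \<alpha>\<^esub> h) \<one>\<^bsub>G \<alpha>\<^esub>"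
proof -
  interpret \<alpha>: group "G \<alpha>" using assms(1) by (rule grp)
  show ?thesis
    using right_invariant[of \<alpha> "inv\<^bsub>G \<alpha>\<^esub> h" g h] assms by simp
qed

context
  fixes G :: "nat \<Rightarrow> ('a, 'b) monoid_scheme" and d :: "nat \<Rightarrow> 'a \<Rightarrow> 'a \<Rightarrow> real"
    and \<epsilon> :: "nat \<Rightarrow> real" and \<omega> :: "nat filter"
  assumes fam: "approximating_family UNIV G d \<epsilon>"
begin

interpretation approximating_family UNIV G d \<epsilon> by (rule fam)

interpretation N: normal "null_seqs G d \<omega>" "product_group UNIV G"
  by (rule null_seqs_normal[OF fam])

lemma group_ultraproduct: "group (ultraproduct G d \<omega>)"
  unfolding ultraproduct_def by (rule N.factorgroup_is_group)

lemma ultra_class_hom: "ultra_class G d \<omega> \<in> hom (product_group UNIV G) (ultraproduct G d \<omega>)"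
proof -
  have "ultra_class G d \<omega> = (\<lambda>g. null_seqs G d \<omega> #>\<^bsub>product_group UNIV G\<^esub> g)"
    by (rule ext) (simp add: ultra_class_def)
  then show ?thesis unfolding ultraproduct_def using N.r_coset_hom_Mod by simp
qed

lemma carrier_ultraproduct:
  "carrier (ultraproduct G d \<omega>) = ultra_class G d \<omega> ` carrier (product_group UNIV G)"
  unfolding ultraproduct_def carrier_FactGroup ultra_class_def ..

lemma ultra_class_eq_one_iff:
  assumes "g \<in> carrier (product_group UNIV G)"
  shows "ultra_class G d \<omega> g = \<one>\<^bsub>ultraproduct G d \<omega>\<^esub> \<longleftrightarrow>
    ((\<lambda>k. d k (g k) \<one>\<^bsub>G k\<^esub>) \<longlongrightarrow> 0) \<omega>"
proof -
  have "ultra_class G d \<omega> g = \<one>\<^bsub>ultraproduct G d \<omega>\<^esub> \<longleftrightarrow> g \<in> null_seqs G d \<omega>"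
    using N.rcos_self[OF assms N.subgroup_axioms] N.rcos_const[of g] assms
    by (auto simp: ultra_class_def ultraproduct_def simp del: carrier_product_group)
  then show ?thesis using assms by (auto simp: null_seqs_def)
qed

context
  fixes \<phi> :: "'x \<Rightarrow> nat \<Rightarrow> 'a" and X :: "'x set"
  assumes \<phi>: "\<And>x k. x \<in> X \<Longrightarrow> \<phi> x k \<in> carrier (G k)"
begin

lemma pointwise_word_eval_closed:
  "fst ` set w \<subseteq> X \<Longrightarrow> (\<lambda>k. word_eval (G k) (\<lambda>x. \<phi> x k) w) \<in> carrier (product_group UNIV G)"
  by (auto intro!: word_eval_closed[where X = X] grp simp: \<phi>)

lemma pointwise_word_eval:
  assumes "fst ` set w \<subseteq> X"
  shows "(\<lambda>k. word_eval (G k) (\<lambda>x. \<phi> x k) w) = word_eval (product_group UNIV G) \<phi> w"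
  by (rule ext, rule word_eval_product_group[symmetric, OF _ _ assms]) (auto simp: grp \<phi>)

lemma ultra_class_word_eval_hom:
  "(\<lambda>w. ultra_class G d \<omega> (\<lambda>k. word_eval (G k) (\<lambda>x. \<phi> x k) w))
     \<in> hom (free_group X) (ultraproduct G d \<omega>)"
proof -
  have "word_eval (product_group UNIV G) \<phi> \<in> hom (free_group X) (product_group UNIV G)"
    by (rule word_eval_hom) (auto simp: grp \<phi>)
  from hom_compose[OF this ultra_class_hom] show ?thesis
    by (rule group.hom_restrict[OF group_free_group])
      (auto simp: pointwise_word_eval free_group_def)
qed

text \<open>A homomorphism out of the free group is determined on the generators, and evaluation of words commutes with the
  quotient map from the product. So one choice of representatives for the images of the generators yields
  representatives for the images of all words.\<close>

lemma free_group_hom_ultraproduct: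
  assumes t: "t \<in> hom (free_group X) (ultraproduct G d \<omega>)"
    and gen: "\<And>x. x \<in> X \<Longrightarrow> t [(x, True)] = ultra_class G d \<omega> (\<phi> x)"
    and w: "w \<in> carrier (free_group X)"
  shows "t w = ultra_class G d \<omega> (\<lambda>k. word_eval (G k) (\<lambda>x. \<phi> x k) w)"
proof -
  have wX: "fst ` set w \<subseteq> X" using w by (simp add: free_group_def)
  have "t w = word_eval (ultraproduct G d \<omega>) (\<lambda>x. t [(x, True)]) w"
    by (rule free_group_hom_eq_word_eval[OF group_ultraproduct t w])
  also have "\<dots> = word_eval (ultraproduct G d \<omega>) (\<lambda>x. ultra_class G d \<omega> (\<phi> x)) w"
    by (rule word_eval_cong) (use gen wX in auto)
  also have "\<dots> = ultra_class G d \<omega> (word_eval (product_group UNIV G) \<phi> w)"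
    by (rule hom_word_eval[symmetric, OF _ group_ultraproduct ultra_class_hom _ wX])
      (auto simp: grp \<phi>)
  finally show ?thesis by (simp only: pointwise_word_eval[OF wX])
qed

end

end


section \<open>Solutions and homomorphisms\<close>

abbreviation gens :: "nat \<Rightarrow> nat \<Rightarrow> gen set" where
  "gens l m \<equiv> Coeff ` {1..l} \<union> Var ` {1..m}"

lemma finite_short_words: "finite {w \<in> carrier (free_prod l m). real (length w) \<le> r}"
proof (rule finite_subset)
  let ?A = "gens l m \<times> (UNIV :: bool set)"
  show "finite {w. set w \<subseteq> ?A \<and> length w \<le> nat \<lfloor>r\<rfloor>}"
    by (rule finite_lists_length_le) auto
  show "{w \<in> carrier (free_prod l m). real (length w) \<le> r} \<subseteq>
      {w. set w \<subseteq> ?A \<and> length w \<le> nat \<lfloor>r\<rfloor>}"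
    by (auto simp: free_prod_def free_group_def le_nat_floor)
qed

text \<open>The relators give null sequences, hence a homomorphism on the quotient. For distinct cosets of \<open>u\<close> and \<open>v\<close>
  the word \<open>u v\<^sup>-\<^sup>1\<close> is not in \<open>N\<close> and is short enough for almost all \<open>k\<close>; the lower bound on its value passes to
  the limit.\<close>

lemma ultraproduct_hom_of_strong_solutions:
  fixes G :: "nat \<Rightarrow> ('a, 'b) monoid_scheme"
  assumes fam: "approximating_family UNIV G d \<epsilon>"
    and \<omega>: "nonprincipal_ultrafilter \<omega>" "\<omega> \<le> sequentially"
    and a: "\<forall>k. \<forall>i\<in>{1..l}. a k i \<in> carrier (G k)"
    and W: "W \<subseteq> carrier (free_prod l m)"
    and sol: "\<And>k. strong_solution (G k) (d k) (\<epsilon> k) l m W (a k) (1 / real (Suc k)) (h k)"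
  defines "F \<equiv> free_prod l m"
  defines "N \<equiv> normal_closure F W"
  shows "\<exists>\<theta>. \<theta> \<in> hom (F Mod N) (ultraproduct G d \<omega>) \<and>
     (\<forall>A \<in> carrier (F Mod N). \<forall>B \<in> carrier (F Mod N). A \<noteq> B \<longrightarrow>
       Lim \<omega> (\<lambda>k. ereal (\<epsilon> k)) \<le> ultra_dist d \<omega> (\<theta> A) (\<theta> B)) \<and>
     (\<forall>i\<in>{1..l}. \<theta> (N #>\<^bsub>F\<^esub> [(Coeff i, True)]) = ultra_class G d \<omega> (\<lambda>k. a k i))"
proof -
  interpret approximating_family UNIV G d \<epsilon> by (rule fam)
  have F: "F = free_group (gens l m)" by (simp add: F_def free_prod_def)
  interpret F: group F unfolding F by (rule group_free_group)
  have WF: "W \<subseteq> carrier F" using W by (simp add: F_def)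
  interpret N: normal N F
    unfolding N_def by (rule normal_closure_normal[OF F.group_axioms WF])
  have nb: "\<omega> \<noteq> bot" using \<omega> by (simp add: nonprincipal_ultrafilter_def)
  define \<phi> where "\<phi> x k = case_gen (a k) (h k) x" for x k
  have \<phi>: "\<phi> x k \<in> carrier (G k)" if "x \<in> gens l m" for x k
    using that a sol[of k] by (auto simp: \<phi>_def strong_solution_def)
  define ev where "ev w k = word_eval (G k) (\<lambda>x. \<phi> x k) w" for w k
  have ev_hom: "(\<lambda>w. ev w k) \<in> hom F (G k)" for k
    unfolding F ev_def by (rule word_eval_hom) (auto simp: grp \<phi>)
  have ev_P: "ev w \<in> carrier (product_group UNIV G)" if "w \<in> carrier F" for w
    using hom_in_carrier[OF ev_hom that] by auto
  let ?t = "\<lambda>w. ultra_class G d \<omega> (ev w)"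
  have t: "?t \<in> hom F (ultraproduct G d \<omega>)"
    unfolding F ev_def using \<phi> by (rule ultra_class_word_eval_hom[OF fam])

  \<comment> \<open>This is the length condition of a strong solution with the parameter of the \<open>k\<close>-th group.\<close>
  have short: "\<forall>\<^sub>F k in \<omega>. real (length w) \<le> 1 / (1 / real (Suc k))" for w :: "gen word"
    by (rule filter_leD[OF \<omega>(2)]) (rule eventually_sequentiallyI[of "length w"], simp)
  have \<delta>0: "((\<lambda>k. 1 / real (Suc k)) \<longlongrightarrow> 0) \<omega>"
    by (rule tendsto_mono[OF \<omega>(2)]) (rule LIMSEQ_Suc[OF lim_1_over_n])
  have eq: "d k (ev w k) \<one>\<^bsub>G k\<^esub> = d k (word_eval (G k) (case_gen (a k) (h k)) w) \<one>\<^bsub>G k\<^esub>" for w k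
    by (simp add: ev_def \<phi>_def)
  have relator: "?t w = \<one>\<^bsub>ultraproduct G d \<omega>\<^esub>" if w: "w \<in> W" for w
  proof -
    have "\<forall>\<^sub>F k in \<omega>. norm (d k (ev w k) \<one>\<^bsub>G k\<^esub>) \<le> 1 / real (Suc k)"
      using short[of w]
    proof eventually_elim
      case (elim k)
      have "0 \<le> d k (ev w k) \<one>\<^bsub>G k\<^esub>"
        by (rule Metric_space.nonneg[OF metric]) simp
      moreover have "d k (ev w k) \<one>\<^bsub>G k\<^esub> < 1 / real (Suc k)"
        using sol[of k] elim w W unfolding strong_solution_def eq by blast
      ultimately show ?case by simp
    qed
    then have "((\<lambda>k. d k (ev w k) \<one>\<^bsub>G k\<^esub>) \<longlongrightarrow> 0) \<omega>"
      by (rule Lim_null_comparison[OF _ \<delta>0])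
    then show ?thesis
      using ultra_class_eq_one_iff[OF fam ev_P] w WF by blast
  qed
  have "N \<subseteq> kernel F (ultraproduct G d \<omega>) ?t"
    unfolding N_def
    by (rule normal_closure_subset_kernel[OF F.group_axioms group_ultraproduct[OF fam] t WF relator])
  then obtain \<theta> where \<theta>: "\<theta> \<in> hom (F Mod N) (ultraproduct G d \<omega>)"
    and \<theta>_coset: "\<And>x. x \<in> carrier F \<Longrightarrow> \<theta> (N #>\<^bsub>F\<^esub> x) = ?t x"
    using FactGroup_hom_of_subset_kernel[OF F.group_axioms group_ultraproduct[OF fam] t N.normal_axioms]
    by blast
  show ?thesis
  proof (intro exI[of _ \<theta>] conjI ballI impI)
    fix i assume i: "i \<in> {1..l}"
    then have "[(Coeff i, True)] \<in> carrier F" by (auto simp: F free_group_def)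
    then have "\<theta> (N #>\<^bsub>F\<^esub> [(Coeff i, True)]) = ultra_class G d \<omega> (ev [(Coeff i, True)])"
      by (rule \<theta>_coset)
    also have "ev [(Coeff i, True)] = (\<lambda>k. a k i)"
    proof
      fix k
      have "ev [(Coeff i, True)] k = \<phi> (Coeff i) k"
        unfolding ev_def by (rule word_eval_gen[where X = "gens l m"]) (use i in \<open>auto simp: grp \<phi>\<close>)
      then show "ev [(Coeff i, True)] k = a k i" by (simp add: \<phi>_def)
    qed
    finally show "\<theta> (N #>\<^bsub>F\<^esub> [(Coeff i, True)]) = ultra_class G d \<omega> (\<lambda>k. a k i)" .
  next
    fix A B assume "A \<in> carrier (F Mod N)" "B \<in> carrier (F Mod N)" and AB: "A \<noteq> B"
    then obtain u v where u: "u \<in> carrier F" "A = N #>\<^bsub>F\<^esub> u" and v: "v \<in> carrier F" "B = N #>\<^bsub>F\<^esub> v"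
      unfolding carrier_FactGroup by blast
    let ?w = "u \<otimes>\<^bsub>F\<^esub> inv\<^bsub>F\<^esub> v"
    have w: "?w \<in> carrier F" using u v by simp
    have wN: "?w \<notin> N"
      using AB u v F.rcos_eq_iff[OF N.subgroup_axioms, of u v] by blast
    have dist: "d k (ev u k) (ev v k) = d k (ev ?w k) \<one>\<^bsub>G k\<^esub>" for k
    proof -
      interpret k: group_hom F "G k" "\<lambda>w. ev w k"
        using ev_hom by (simp add: group_hom_def group_hom_axioms_def F.group_axioms grp)
      show ?thesis
        using dist_eq_dist_one[of k "ev u k" "ev v k"] u v by simp
    qed
    have low: "\<forall>\<^sub>F k in \<omega>. ereal (\<epsilon> k - 1 / real (Suc k)) \<le> ereal (d k (ev u k) (ev v k))"
      using short[of ?w]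
    proof eventually_elim
      case (elim k)
      have "\<epsilon> k - 1 / real (Suc k) \<le> d k (ev ?w k) \<one>\<^bsub>G k\<^esub>"
        using sol[of k] elim w wN unfolding strong_solution_def eq N_def F_def by blast
      then show ?case by (simp add: dist)
    qed
    obtain L where L: "((\<lambda>k. ereal (\<epsilon> k)) \<longlongrightarrow> L) \<omega>"
      using ultrafilter_tendsto[OF \<omega>(1)] by blast
    have "((\<lambda>k. ereal (- (1 / real (Suc k)))) \<longlongrightarrow> ereal 0) \<omega>"
      using tendsto_minus[OF \<delta>0] by (intro tendsto_ereal) simp
    from tendsto_add_ereal_general1[OF _ L this]
    have "((\<lambda>k. ereal (\<epsilon> k - 1 / real (Suc k))) \<longlongrightarrow> L) \<omega>"
      by (simp add: zero_ereal_def[symmetric])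
    moreover have "((\<lambda>k. ereal (d k (ev u k) (ev v k))) \<longlongrightarrow> ultra_dist d \<omega> (?t u) (?t v)) \<omega>"
      by (rule tendsto_ultra_dist[OF fam \<omega>(1) ev_P ev_P]) (use u v in auto)
    ultimately have "L \<le> ultra_dist d \<omega> (?t u) (?t v)"
      using tendsto_le[OF nb _ _ low] by blast
    then show "Lim \<omega> (\<lambda>k. ereal (\<epsilon> k)) \<le> ultra_dist d \<omega> (\<theta> A) (\<theta> B)"
      using tendsto_Lim[OF nb L] u v by (simp add: \<theta>_coset)
  qed (rule \<theta>)
qed

text \<open>The coefficients are represented by the given sequences themselves, the images of the variables by arbitrary
  representatives. Relators then have null sequences as values, and the values of the finitely many short words outside \<open>N\<close>
  stay away from the identity in the limit. An index that is good for all these words at once gives the solution.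
  The boundedness assumption ensures that a lower bound on limits gives a lower bound on almost all terms.\<close>

lemma strong_solution_of_ultraproduct_hom:
  fixes G :: "nat \<Rightarrow> ('a, 'b) monoid_scheme"
  assumes fam: "approximating_family UNIV G d \<epsilon>"
    and \<omega>: "nonprincipal_ultrafilter \<omega>"
    and bdd: "(\<exists>C. \<forall>k. \<epsilon> k \<le> C) \<or>
      (\<exists>C. \<forall>k. \<forall>g\<in>carrier (G k). \<forall>h\<in>carrier (G k). d k g h \<le> C)"
    and a: "\<forall>k. \<forall>i\<in>{1..l}. a k i \<in> carrier (G k)"
    and W: "finite W" "W \<subseteq> carrier (free_prod l m)"
  defines "F \<equiv> free_prod l m"
  defines "N \<equiv> normal_closure F W"
  assumes \<theta>: "\<theta> \<in> hom (F Mod N) (ultraproduct G d \<omega>)"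
    and sep: "\<forall>A \<in> carrier (F Mod N). \<forall>B \<in> carrier (F Mod N). A \<noteq> B \<longrightarrow>
       Lim \<omega> (\<lambda>k. ereal (\<epsilon> k)) \<le> ultra_dist d \<omega> (\<theta> A) (\<theta> B)"
    and coeff: "\<forall>i\<in>{1..l}.
       \<theta> (N #>\<^bsub>F\<^esub> [(Coeff i, True)]) = ultra_class G d \<omega> (\<lambda>k. a k i)"
    and \<delta>: "0 < \<delta>"
  obtains k h where "strong_solution (G k) (d k) (\<epsilon> k) l m W (a k) \<delta> h"
proof -
  interpret approximating_family UNIV G d \<epsilon> by (rule fam)
  have F: "F = free_group (gens l m)" by (simp add: F_def free_prod_def)
  interpret F: group F unfolding F by (rule group_free_group)
  have WF: "W \<subseteq> carrier F" using W by (simp add: F_def)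
  interpret N: normal N F
    unfolding N_def by (rule normal_closure_normal[OF F.group_axioms WF])
  interpret Q: group "F Mod N" by (rule N.factorgroup_is_group)
  interpret U: group "ultraproduct G d \<omega>" by (rule group_ultraproduct[OF fam])
  interpret \<theta>: group_hom "F Mod N" "ultraproduct G d \<omega>" \<theta>
    using \<theta> by (simp add: group_hom_def group_hom_axioms_def Q.group_axioms U.group_axioms)
  have nb: "\<omega> \<noteq> bot" using \<omega> by (simp add: nonprincipal_ultrafilter_def)
  define t where "t = \<theta> \<circ> (\<lambda>w. N #>\<^bsub>F\<^esub> w)"
  have t: "t \<in> hom F (ultraproduct G d \<omega>)"
    unfolding t_def by (rule hom_compose[OF N.r_coset_hom_Mod \<theta>])
  have "\<exists>g. j \<in> {1..m} \<longrightarrow>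
      g \<in> carrier (product_group UNIV G) \<and> t [(Var j, True)] = ultra_class G d \<omega> g" for j
  proof (cases "j \<in> {1..m}")
    case True
    then have "[(Var j, True)] \<in> carrier F" by (auto simp: F free_group_def)
    from hom_in_carrier[OF t this] show ?thesis
      unfolding carrier_ultraproduct[OF fam] by blast
  qed auto
  then obtain h where h: "\<And>j. j \<in> {1..m} \<Longrightarrow> h j \<in> carrier (product_group UNIV G)"
    and h_class: "\<And>j. j \<in> {1..m} \<Longrightarrow> t [(Var j, True)] = ultra_class G d \<omega> (h j)"
    by metis
  define \<phi> where "\<phi> = case_gen (\<lambda>i k. a k i) h"
  have \<phi>: "\<phi> x k \<in> carrier (G k)" if "x \<in> gens l m" for x k
  proof -
    have "h j k \<in> carrier (G k)" if "j \<in> {1..m}" for j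
      using h[OF that] by auto
    with that a show ?thesis by (auto simp: \<phi>_def)
  qed
  define ev where "ev w k = word_eval (G k) (\<lambda>x. \<phi> x k) w" for w k
  have ev_P: "ev w \<in> carrier (product_group UNIV G)" if "w \<in> carrier F" for w
    unfolding ev_def using \<phi> that
    by (intro pointwise_word_eval_closed[OF fam, where X = "gens l m"]) (auto simp: F free_group_def)
  have gen: "t [(x, True)] = ultra_class G d \<omega> (\<phi> x)" if "x \<in> gens l m" for x
    using that coeff h_class by (auto simp: \<phi>_def t_def)
  have t_ev: "t w = ultra_class G d \<omega> (ev w)" if "w \<in> carrier F" for w
    unfolding ev_def using \<phi> t[unfolded F] gen that[unfolded F]
    by (rule free_group_hom_ultraproduct[OF fam])
  have t_one: "t \<one>\<^bsub>F\<^esub> = \<one>\<^bsub>ultraproduct G d \<omega>\<^esub>"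
    by (rule hom_one[OF t F.group_axioms U.group_axioms])

  have relators: "\<forall>\<^sub>F k in \<omega>. \<forall>w\<in>W. d k (ev w k) \<one>\<^bsub>G k\<^esub> < \<delta>"
  proof (rule eventually_ball_finite[OF W(1)], rule ballI)
    fix w assume w: "w \<in> W"
    then have wF: "w \<in> carrier F" and wN: "w \<in> N" using WF by (auto simp: N_def normal_closure_def)
    have "t w = t \<one>\<^bsub>F\<^esub>"
      using wN wF by (simp add: t_def N.rcos_const F.coset_mult_one N.subset)
    then have "((\<lambda>k. d k (ev w k) \<one>\<^bsub>G k\<^esub>) \<longlongrightarrow> 0) \<omega>"
      using ultra_class_eq_one_iff[OF fam ev_P[OF wF]] t_ev[OF wF] t_one by simp
    then show "\<forall>\<^sub>F k in \<omega>. d k (ev w k) \<one>\<^bsub>G k\<^esub> < \<delta>"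
      using \<delta> by (rule order_tendstoD)
  qed
  \<comment> \<open>the words on which a strong solution imposes a lower bound\<close>
  let ?S = "{w \<in> carrier F. real (length w) \<le> 1 / \<delta>} - N"
  have nonrelators: "\<forall>\<^sub>F k in \<omega>. \<forall>w\<in>?S. \<epsilon> k - \<delta> < d k (ev w k) \<one>\<^bsub>G k\<^esub>"
  proof (rule eventually_ball_finite, goal_cases)
    case 1
    then show ?case using finite_short_words[of l m "1 / \<delta>"] by (simp add: F_def)
  next
    case 2
    show ?case
    proof
      fix w assume "w \<in> ?S"
      then have wF: "w \<in> carrier F" and wN: "w \<notin> N" by auto
      obtain L where L: "((\<lambda>k. ereal (\<epsilon> k)) \<longlongrightarrow> L) \<omega>"
        using ultrafilter_tendsto[OF \<omega>] by blast
      have one: "(\<lambda>k. \<one>\<^bsub>G k\<^esub>) \<in> carrier (product_group UNIV G)"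
        by (auto intro: monoid.one_closed group.is_monoid grp)
      have cosets: "N #>\<^bsub>F\<^esub> w \<noteq> N" "N #>\<^bsub>F\<^esub> w \<in> carrier (F Mod N)" "N \<in> carrier (F Mod N)"
        using F.rcos_self[OF wF N.subgroup_axioms] wN wF Q.one_closed
        by (auto simp: carrier_FactGroup)
      have "ultra_class G d \<omega> (\<lambda>k. \<one>\<^bsub>G k\<^esub>) = \<one>\<^bsub>ultraproduct G d \<omega>\<^esub>"
        using ultra_class_eq_one_iff[OF fam one]
        by (simp add: Metric_space.mdist_zero[OF metric] monoid.one_closed group.is_monoid grp)
      also have "\<dots> = \<theta> N" using \<theta>.hom_one by simp
      finally have "Lim \<omega> (\<lambda>k. ereal (\<epsilon> k)) \<le>
          ultra_dist d \<omega> (ultra_class G d \<omega> (ev w)) (ultra_class G d \<omega> (\<lambda>k. \<one>\<^bsub>G k\<^esub>))"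
        using sep[rule_format, OF cosets(2,3,1)] t_ev[OF wF] by (simp add: t_def)
      moreover have "(\<exists>C. \<forall>k. \<epsilon> k \<le> C) \<or> (\<exists>C. \<forall>k. d k (ev w k) \<one>\<^bsub>G k\<^esub> \<le> C)"
      proof -
        have "ev w k \<in> carrier (G k)" "\<one>\<^bsub>G k\<^esub> \<in> carrier (G k)" for k
          using ev_P[OF wF] one by auto
        with bdd show ?thesis by blast
      qed
      ultimately show "\<forall>\<^sub>F k in \<omega>. \<epsilon> k - \<delta> < d k (ev w k) \<one>\<^bsub>G k\<^esub>"
        unfolding tendsto_Lim[OF nb L] using \<delta>
        by (intro eventually_diff_less_of_ereal_limits
            [OF tendsto_ultra_dist[OF fam \<omega> ev_P[OF wF] one] L nb _ eps_pos[OF UNIV_I]])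
    qed
  qed
  obtain k where k: "\<forall>w\<in>W. d k (ev w k) \<one>\<^bsub>G k\<^esub> < \<delta>"
      "\<forall>w\<in>?S. \<epsilon> k - \<delta> < d k (ev w k) \<one>\<^bsub>G k\<^esub>"
    using eventually_happens'[OF nb eventually_conj[OF relators nonrelators]] by blast
  have "(\<lambda>x. \<phi> x k) = case_gen (a k) (\<lambda>j. h j k)"
    by (rule ext) (simp add: \<phi>_def split: gen.split)
  then have ev: "ev w k = word_eval (G k) (case_gen (a k) (\<lambda>j. h j k)) w" for w
    by (simp add: ev_def)
  have "h j k \<in> carrier (G k)" if "j \<in> {1..m}" for j
    using h[OF that] by auto
  moreover have "\<epsilon> k - \<delta> \<le> d k (ev w k) \<one>\<^bsub>G k\<^esub>"
    if "w \<in> carrier F" "real (length w) \<le> 1 / \<delta>" "w \<notin> N" for w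
    using k(2) that by (intro less_imp_le) blast
  ultimately have "strong_solution (G k) (d k) (\<epsilon> k) l m W (a k) \<delta> (\<lambda>j. h j k)"
    using k(1) unfolding strong_solution_def ev[symmetric] F_def[symmetric] N_def[symmetric] by blast
  then show thesis by (rule that)
qed


section \<open>Approximability and embeddings\<close>

theorem theorem2p6:
  fixes I :: "'i set"
    and G :: "'i \<Rightarrow> ('a, 'b) monoid_scheme"
    and d :: "'i \<Rightarrow> 'a \<Rightarrow> 'a \<Rightarrow> real"
    and \<epsilon> :: "'i \<Rightarrow> real"
    and l m :: nat
    and a :: "'i \<Rightarrow> nat \<Rightarrow> 'a"
    and W :: "gen word set"
  assumes family: "approximating_family I G d \<epsilon>"
    and limits: "bdd_above (\<epsilon> ` I) \<or>
      (\<exists>C. \<forall>\<alpha>\<in>I. \<forall>g\<in>carrier (G \<alpha>). \<forall>h\<in>carrier (G \<alpha>). d \<alpha> g h \<le> C)"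
    and m: "m \<ge> 1"
    and coeffs: "\<And>\<alpha> i. \<alpha> \<in> I \<Longrightarrow> i \<in> {1..l} \<Longrightarrow> a \<alpha> i \<in> carrier (G \<alpha>)"
    and system: "finite W" "W \<subseteq> carrier (free_prod l m)"
  shows "constraint_approximable I G d \<epsilon> l m W a \<longleftrightarrow>
    (\<exists>\<omega> f \<theta>. nonprincipal_ultrafilter \<omega> \<and> f \<in> (UNIV :: nat set) \<rightarrow> I \<and>
       \<theta> \<in> hom (free_prod l m Mod normal_closure (free_prod l m) W)
              (ultraproduct (\<lambda>k. G (f k)) (\<lambda>k. d (f k)) \<omega>) \<and>
       (INF \<alpha>\<in>I. ereal (\<epsilon> \<alpha>)) \<le> Lim \<omega> (\<lambda>k. ereal (\<epsilon> (f k))) \<and>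
       (\<forall>g \<in> carrier (free_prod l m Mod normal_closure (free_prod l m) W).
        \<forall>h \<in> carrier (free_prod l m Mod normal_closure (free_prod l m) W).
          g \<noteq> h \<longrightarrow>
          ultra_dist (\<lambda>k. d (f k)) \<omega> (\<theta> g) (\<theta> h) \<ge> Lim \<omega> (\<lambda>k. ereal (\<epsilon> (f k)))) \<and>
       (\<forall>i\<in>{1..l}.
          \<theta> (normal_closure (free_prod l m) W #>\<^bsub>free_prod l m\<^esub> [(Coeff i, True)]) =
          ultra_class (\<lambda>k. G (f k)) (\<lambda>k. d (f k)) \<omega> (\<lambda>k. a (f k) i)))"
proof (rule iffI, goal_cases)
  case 1
  have "\<exists>\<alpha> h. \<alpha> \<in> I \<and> strong_solution (G \<alpha>) (d \<alpha>) (\<epsilon> \<alpha>) l m W (a \<alpha>) (1 / real (Suc k)) h" for k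
  proof -
    have "0 < 1 / real (Suc k)" by simp
    with 1 show ?thesis unfolding constraint_approximable_def by blast
  qed
  then obtain f h where fI: "\<And>k. f k \<in> I"
    and sol: "\<And>k. strong_solution (G (f k)) (d (f k)) (\<epsilon> (f k)) l m W (a (f k)) (1 / real (Suc k)) (h k)"
    by metis
  then have f: "f \<in> UNIV \<rightarrow> I" by auto
  have coeffs': "\<forall>k. \<forall>i\<in>{1..l}. a (f k) i \<in> carrier (G (f k))"
    using coeffs[OF fI] by blast
  obtain \<omega> :: "nat filter" where \<omega>: "nonprincipal_ultrafilter \<omega>" "\<omega> \<le> sequentially"
    by (rule ex_nonprincipal_ultrafilter_nat)
  then have nb: "\<omega> \<noteq> bot" by (simp add: nonprincipal_ultrafilter_def)
  obtain L where L: "((\<lambda>k. ereal (\<epsilon> (f k))) \<longlongrightarrow> L) \<omega>"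
    using ultrafilter_tendsto[OF \<omega>(1)] by blast
  have "(INF \<alpha>\<in>I. ereal (\<epsilon> \<alpha>)) \<le> L"
    by (rule tendsto_lowerbound[OF L _ nb]) (intro always_eventually allI INF_lower fI)
  then have "(INF \<alpha>\<in>I. ereal (\<epsilon> \<alpha>)) \<le> Lim \<omega> (\<lambda>k. ereal (\<epsilon> (f k)))"
    by (simp add: tendsto_Lim[OF nb L])
  moreover obtain \<theta> where
    "\<theta> \<in> hom (free_prod l m Mod normal_closure (free_prod l m) W)
      (ultraproduct (\<lambda>k. G (f k)) (\<lambda>k. d (f k)) \<omega>)"
    "\<forall>g \<in> carrier (free_prod l m Mod normal_closure (free_prod l m) W).
      \<forall>h \<in> carrier (free_prod l m Mod normal_closure (free_prod l m) W).
        g \<noteq> h \<longrightarrow>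
        ultra_dist (\<lambda>k. d (f k)) \<omega> (\<theta> g) (\<theta> h) \<ge> Lim \<omega> (\<lambda>k. ereal (\<epsilon> (f k)))"
    "\<forall>i\<in>{1..l}.
      \<theta> (normal_closure (free_prod l m) W #>\<^bsub>free_prod l m\<^esub> [(Coeff i, True)]) =
      ultra_class (\<lambda>k. G (f k)) (\<lambda>k. d (f k)) \<omega> (\<lambda>k. a (f k) i)"
    by (rule ultraproduct_hom_of_strong_solutions
          [OF approximating_family_reindex[OF family f] \<omega> coeffs' system(2) sol,
            THEN exE]) (elim conjE, rule that)
  moreover note \<omega>(1) f
  ultimately show ?case
    by (intro exI[of _ \<omega>] exI[of _ f] exI[of _ \<theta>] conjI)
next
  case 2
  then obtain \<omega> f \<theta> where \<omega>: "nonprincipal_ultrafilter \<omega>" and f: "f \<in> (UNIV :: nat set) \<rightarrow> I"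
    and \<theta>: "\<theta> \<in> hom (free_prod l m Mod normal_closure (free_prod l m) W)
        (ultraproduct (\<lambda>k. G (f k)) (\<lambda>k. d (f k)) \<omega>)"
      "\<forall>g \<in> carrier (free_prod l m Mod normal_closure (free_prod l m) W).
        \<forall>h \<in> carrier (free_prod l m Mod normal_closure (free_prod l m) W).
          g \<noteq> h \<longrightarrow>
          ultra_dist (\<lambda>k. d (f k)) \<omega> (\<theta> g) (\<theta> h) \<ge> Lim \<omega> (\<lambda>k. ereal (\<epsilon> (f k)))"
      "\<forall>i\<in>{1..l}.
        \<theta> (normal_closure (free_prod l m) W #>\<^bsub>free_prod l m\<^esub> [(Coeff i, True)]) =
        ultra_class (\<lambda>k. G (f k)) (\<lambda>k. d (f k)) \<omega> (\<lambda>k. a (f k) i)"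
    by (elim exE conjE) (rule that)
  have fI: "f k \<in> I" for k using f by auto
  have coeffs': "\<forall>k. \<forall>i\<in>{1..l}. a (f k) i \<in> carrier (G (f k))"
    using coeffs[OF fI] by blast
  have bdd: "(\<exists>C. \<forall>k. \<epsilon> (f k) \<le> C) \<or>
      (\<exists>C. \<forall>k. \<forall>g\<in>carrier (G (f k)). \<forall>h\<in>carrier (G (f k)). d (f k) g h \<le> C)"
    using limits fI unfolding bdd_above_def by blast
  show ?case
    unfolding constraint_approximable_def
  proof (intro allI impI)
    fix \<delta> :: real assume \<delta>: "0 < \<delta>"
    obtain k h where "strong_solution (G (f k)) (d (f k)) (\<epsilon> (f k)) l m W (a (f k)) \<delta> h"
      by (rule strong_solution_of_ultraproduct_hom[OF approximating_family_reindex[OF family f]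
            \<omega> bdd coeffs' system \<theta> \<delta>])
    with fI show "\<exists>\<alpha>\<in>I. \<exists>h. strong_solution (G \<alpha>) (d \<alpha>) (\<epsilon> \<alpha>) l m W (a \<alpha>) \<delta> h" by blast
  qed
qed

end
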